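(* Let $g,h$ be functions satisfying all the conditions listed in the context, let $Z(x+iy)=g(x)h(y)$, and for $a>0$ let $f(z)=Z(z)-a$ be the corresponding generalised exponential. Then there exist $m<0$ and $M>0$ (depending only on $Z$, not on $a$) such that, whenever $a$ is sufficiently large, $f$ has a unique attracting fixed point $\xi\in\mathbb{H}_m$, $f(\mathbb{H}_M)\subset\mathbb{H}_m$, and $f^n(z)\to\xi$ as $n\to\infty$ for every $z\in\mathbb{H}_M$.
   Context: Throughout $\mathbb{R}^2$ is identified with $\mathbb{C}$, and $f^n$ denotes the $n$th iterate of $f$. For $r\in\mathbb{R}$, $\mathbb{H}_r=\{x+iy\in\mathbb{C}: x\le r\}$. The function $h$. Let $\eta$ be a simple curve from $-i$ to $i$ such that $\eta\setminus\{-i,i\}\subset\{z\in\mathbb{C}:\operatorname{Re} z>0,\ |z|\le 1\}$ and such that for each $\theta\in[-\pi/2,\pi/2]$ the curve $\eta$ contains exactly one point of argument $\theta$. Let $h:[-\pi/2,\pi/2]\to\eta$ be a biLipschitz map with $h(\pm\pi/2)=\pm i$. Extend $h$ to $h:\mathbb{R}\to\eta\cup(-\eta)$ as follows: if $y\in\mathbb{R}$ and $y'\in[-\pi/2,\pi/2]$ is such that $y'=y+p\pi$ with $p\in\mathbb{Z}$, then $h(y)=h(y')$ if $p$ is even and $h(y)=-h(y')$ if $p$ is odd. Let $h_{\min}\in(0,1)$ be a constant with $h_{\min}\le|h(y)|\le1$ for all $y\in\mathbb{R}$. The function $g$. Let $g:\mathbb{R}\to(0,\infty)$ be continuous and such that: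 (A) $g$ is strictly increasing and $g(x)\to0$ as $x\to-\infty$; (B) the derivative $g'(x)$ is defined almost everywhere and is monotonically non-decreasing where it is defined; and there exists $c>1/h_{\min}>1$ such that $g(x+2\pi)\ge c\,g(x)$ for all sufficiently large $x$. Define $Z:\mathbb{C}\to\mathbb{C}$ by $Z(x+iy)=g(x)h(y)$ and, for $a>0$, $f(z)=Z(z)-a$. Such a map $f$ is called a generalised exponential.
   Formalization: In (B), g' is required to be non-decreasing also at points where it equals +∞; comparing only finite derivatives, exp plus small Cantor steps placed toward −∞ satisfies all conditions but gives several fixed points for arbitrarily large a. *)

theory Defs
  imports "HOL-Analysis.Analysis"
begin

definition half_plane :: "real \<Rightarrow> complex set"  ("\<H>")
  where "\<H> r = {z. Re z \<le> r}"

text \<open>The curve \<open>\<eta>\<close> is represented by its trace. Since its endpoints differ, ``simple'' means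
  \<^const>\<open>arc\<close>. Note that \<open>0 \<notin> \<eta>\<close> by the third condition, so the convention \<open>Arg 0 = 0\<close>
  plays no role.\<close>

definition admissible_curve :: "complex set \<Rightarrow> bool" where
  "admissible_curve \<eta> \<longleftrightarrow>
     (\<exists>\<gamma>. arc \<gamma> \<and> pathstart \<gamma> = -\<i> \<and> pathfinish \<gamma> = \<i> \<and> path_image \<gamma> = \<eta>) \<and>
     \<eta> - {-\<i>, \<i>} \<subseteq> {z. Re z > 0 \<and> norm z \<le> 1} \<and>
     (\<forall>\<theta>\<in>{-(pi/2)..pi/2}. \<exists>!z. z \<in> \<eta> \<and> Arg z = \<theta>)"

definition bilipschitz_on :: "'a::metric_space set \<Rightarrow> ('a \<Rightarrow> 'b::metric_space) \<Rightarrow> bool" where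
  "bilipschitz_on S f \<longleftrightarrow>
     (\<exists>L>0. \<forall>x\<in>S. \<forall>y\<in>S. dist x y / L \<le> dist (f x) (f y) \<and> dist (f x) (f y) \<le> L * dist x y)"

text \<open>Here \<open>h\<close> is already the extension to the whole real line; the last conjunct states how it is
  determined by its restriction to \<open>[-\<pi>/2, \<pi>/2]\<close>.\<close>

definition admissible_h :: "complex set \<Rightarrow> (real \<Rightarrow> complex) \<Rightarrow> bool" where
  "admissible_h \<eta> h \<longleftrightarrow>
     h ` {-(pi/2)..pi/2} \<subseteq> \<eta> \<and>
     bilipschitz_on {-(pi/2)..pi/2} h \<and>
     h (pi/2) = \<i> \<and> h (-(pi/2)) = -\<i> \<and>
     (\<forall>y. \<forall>y'\<in>{-(pi/2)..pi/2}. \<forall>p::int. y' = y + of_int p * pi \<longrightarrow>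
        h y = (if even p then h y' else - h y'))"

text \<open>Derivative, with the infinite values allowed.\<close>

definition has_ext_derivative :: "(real \<Rightarrow> real) \<Rightarrow> ereal \<Rightarrow> real \<Rightarrow> bool" where
  "has_ext_derivative g D x \<longleftrightarrow> ((\<lambda>y. ereal ((g y - g x) / (y - x))) \<longlongrightarrow> D) (at x)"

lemma has_ext_derivative_ereal_iff:
  "has_ext_derivative g (ereal d) x \<longleftrightarrow> (g has_real_derivative d) (at x)"
  by (simp add: has_ext_derivative_def has_field_derivative_iff)

text \<open>The derivative of \<open>g\<close> is required to be non-decreasing wherever it exists, points with
  derivative \<open>\<infinity>\<close> included. If only finite derivatives were compared, then adding to
  \<open>exp\<close> a continuous singular function (such as Cantor functions placed along the line) would not
  be excluded. Finiteness almost everywhere is what \<open>differentiable\<close> expresses.\<close>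

definition admissible_g :: "real \<Rightarrow> (real \<Rightarrow> real) \<Rightarrow> bool" where
  "admissible_g h\<^sub>m\<^sub>i\<^sub>n g \<longleftrightarrow>
     (\<forall>x. g x > 0) \<and> continuous_on UNIV g \<and>
     strict_mono g \<and> (g \<longlongrightarrow> 0) at_bot \<and>
     (AE x in lborel. g differentiable (at x)) \<and>
     (\<forall>x y D E. x \<le> y \<and> has_ext_derivative g D x \<and> has_ext_derivative g E y \<longrightarrow> D \<le> E) \<and>
     (\<exists>c > 1 / h\<^sub>m\<^sub>i\<^sub>n. \<forall>\<^sub>F x in at_top. g (x + 2 * pi) \<ge> c * g x)"

definition Z_map :: "(real \<Rightarrow> real) \<Rightarrow> (real \<Rightarrow> complex) \<Rightarrow> complex \<Rightarrow> complex" where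
  "Z_map g h z = complex_of_real (g (Re z)) * h (Im z)"

definition gen_exp :: "(real \<Rightarrow> real) \<Rightarrow> (real \<Rightarrow> complex) \<Rightarrow> real \<Rightarrow> complex \<Rightarrow> complex" where
  "gen_exp g h a z = Z_map g h z - complex_of_real a"

text \<open>As the maps need not be differentiable, ``attracting'' is meant topologically (as in Milnor's
  book on complex dynamics): the iterates converge to the fixed point, uniformly on some
  neighbourhood of it.\<close>

definition attracting_fixed_point :: "('a::metric_space \<Rightarrow> 'a) \<Rightarrow> 'a \<Rightarrow> bool" where
  "attracting_fixed_point f \<xi> \<longleftrightarrow> f \<xi> = \<xi> \<and>
     (\<exists>U. open U \<and> \<xi> \<in> U \<and> uniform_limit U (\<lambda>n. f ^^ n) (\<lambda>_. \<xi>) sequentially)"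

end

theory Submission
  imports Defs
begin

text \<open>
  Subtracting \<open>a\<close> does not affect distances, so \<open>f\<close> contracts whatever \<open>Z\<close> contracts. As \<open>|Z|\<close> is
  bounded by \<open>g M\<close> on \<open>\<H> M\<close>, a large \<open>a\<close> moves \<open>f ` \<H> M\<close> as far to the left as desired. Thus once
  \<open>Z\<close> is known to contract some left half-plane, Banach's fixed point theorem applies to a smaller
  one, and every orbit starting in \<open>\<H> M\<close> enters it after one step
  (\<open>contraction_attracting_fixed_point\<close>).

  That \<open>Z\<close> contracts far to the left follows from the product rule
  (\<open>Z_map_half_lipschitz_near_at_bot\<close>): \<open>h\<close> is bounded and Lipschitz and \<open>g\<close> is small, so what is
  needed is that \<open>g\<close> itself has a small Lipschitz constant near \<open>-\<infinity>\<close>. If \<open>g\<close> were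
  known to be convex this would be clear, but the hypothesis only compares the derivatives of \<open>g\<close> at
  points where they exist, and a continuous increasing function need not be controlled by its
  derivative at almost every point. The lemma \<open>negligible_strict_mono_image\<close> bridges the gap: an
  increasing continuous function maps a null set to a null set unless it has derivative \<open>\<infinity>\<close>
  somewhere on it. A point with derivative \<open>\<infinity>\<close> would, by monotonicity of the derivative,
  forbid finite derivatives anywhere to its right, contradicting differentiability almost everywhere.

  The quantitative tool is a covering argument (\<open>vitali_image_bound\<close>, \<open>increment_bound\<close>), which turns
  pointwise comparisons of slopes into comparisons of increments up to a factor 5. Applied in one
  direction it bounds the slopes of \<open>g\<close> to the left of \<open>b\<close> by \<open>5 K\<close> whenever \<open>K\<close> exceeds \<open>g' b\<close>
  (\<open>increment_le_left_of_derivative\<close>); applied in the other direction it shows that \<open>g' b\<close> takes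
  arbitrarily small values far to the left, because \<open>g\<close> is bounded there
  (\<open>small_derivative_far_left\<close>).
\<close>

section \<open>Comparing the increments of two increasing functions\<close>

text \<open>The pairs \<open>x, y\<close> from the hypothesis span intervals whose \<open>p\<close>-images cover
  \<open>p ` E\<close>, so by Vitali's lemma a disjoint subfamily covers \<open>p ` E\<close> once its members are enlarged five times. Since
  \<open>p\<close> and \<open>q\<close> are both increasing, disjointness passes from the \<open>p\<close>-images of these intervals to
  their \<open>q\<close>-images, whose total length therefore fits into \<open>V\<close>.

  Treating \<open>p\<close> and \<open>q\<close> symmetrically makes it possible to use the lemma both for \<open>p = g\<close>, \<open>q = id\<close>
  (small slopes force small images) and for \<open>p = id\<close>, \<open>q = g\<close> (large slopes force large
  increments).\<close>

lemma vitali_image_bound: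
  fixes p q :: "real \<Rightarrow> real"
  assumes p: "strict_mono p" "continuous_on UNIV p" and q: "strict_mono q" "continuous_on UNIV q"
    and V: "open V" "V \<in> lmeasurable" "q ` E \<subseteq> V" and "0 \<le> K"
    and freq: "\<And>x. x \<in> E \<Longrightarrow> \<exists>\<^sub>F y in at x. \<bar>p y - p x\<bar> \<le> K * \<bar>q y - q x\<bar>"
  shows "\<exists>W\<in>lmeasurable. p ` E \<subseteq> W \<and> measure lebesgue W \<le> 5 * K * measure lebesgue V"
proof -
  \<comment> \<open>The bound \<open>1\<close> on the \<open>p\<close>-length is there because the covering lemma needs bounded radii;
    the short \<open>q\<close>-length keeps the \<open>q\<close>-image inside the open set \<open>V\<close>.\<close>
  have "\<exists>u v. u < v \<and> x \<in> {u..v} \<and> p v - p u \<le> K * (q v - q u) \<and> p v - p u \<le> 1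
              \<and> {q u..q v} \<subseteq> V" if x: "x \<in> E" for x
  proof -
    obtain e where e: "e > 0" "ball (q x) e \<subseteq> V"
      using openE[OF V(1), of "q x"] V(3) x by blast
    have "(p \<longlongrightarrow> p x) (at x)" "(q \<longlongrightarrow> q x) (at x)"
      using p(2) q(2) by (simp_all add: continuous_on_def)
    then have "\<forall>\<^sub>F y in at x. dist (p y) (p x) < 1" "\<forall>\<^sub>F y in at x. dist (q y) (q x) < e"
      using e(1) by (simp_all add: tendstoD)
    moreover have "\<forall>\<^sub>F y in at x. y \<noteq> x"
      by (simp add: eventually_at_filter)
    ultimately have "\<forall>\<^sub>F y in at x. y \<noteq> x \<and> dist (p y) (p x) < 1 \<and> dist (q y) (q x) < e"
      by eventually_elim auto
    from frequently_eventually_frequently[OF freq[OF x] this]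
    obtain y where y: "\<bar>p y - p x\<bar> \<le> K * \<bar>q y - q x\<bar>" "y \<noteq> x" "dist (p y) (p x) < 1"
        "dist (q y) (q x) < e"
      by (auto dest: frequently_ex)
    have sub: "{q x..q y} \<subseteq> V" "{q y..q x} \<subseteq> V"
      using e(2) y(4) by (auto simp: subset_iff dist_real_def)
    show ?thesis
    proof (cases "x < y")
      case True
      then show ?thesis
        using y strict_monoD[OF p(1) True] strict_monoD[OF q(1) True] sub
        by (intro exI[of _ x] exI[of _ y]) (auto simp: dist_real_def)
    next
      case False
      then have "y < x" using y(2) by simp
      then show ?thesis
        using y strict_monoD[OF p(1) \<open>y < x\<close>] strict_monoD[OF q(1) \<open>y < x\<close>] sub
        by (intro exI[of _ y] exI[of _ x]) (auto simp: dist_real_def)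
    qed
  qed
  then obtain u v where uv: "\<And>x. x \<in> E \<Longrightarrow> u x < v x" "\<And>x. x \<in> E \<Longrightarrow> x \<in> {u x..v x}"
      "\<And>x. x \<in> E \<Longrightarrow> p (v x) - p (u x) \<le> K * (q (v x) - q (u x))"
      "\<And>x. x \<in> E \<Longrightarrow> p (v x) - p (u x) \<le> 1"
      "\<And>x. x \<in> E \<Longrightarrow> {q (u x)..q (v x)} \<subseteq> V"
    by metis
  define a where "a x = (p (u x) + p (v x)) / 2" for x
  define r where "r x = (p (v x) - p (u x)) / 2" for x
  have ball: "cball (a x) (r x) = {p (u x)..p (v x)}" for x
    by (auto simp: cball_eq_atLeastAtMost a_def r_def field_simps)
  have cover: "p ` E \<subseteq> (\<Union>x\<in>E. cball (a x) (r x))"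
  proof (rule image_subsetI)
    fix x assume x: "x \<in> E"
    then have "p x \<in> {p (u x)..p (v x)}"
      using uv(2)[OF x] by (simp add: strict_mono_less_eq[OF p(1)])
    with x show "p x \<in> (\<Union>x\<in>E. cball (a x) (r x))"
      unfolding ball by blast
  qed
  have r: "0 < r x \<and> r x \<le> 1" if "x \<in> E" for x
    using uv(4)[OF that] strict_monoD[OF p(1) uv(1)[OF that]] by (auto simp: r_def)
  obtain C where C: "countable C" "C \<subseteq> E"
      "pairwise (\<lambda>i j. disjnt (cball (a i) (r i)) (cball (a j) (r j))) C"
      "p ` E \<subseteq> (\<Union>i\<in>C. cball (a i) (5 * r i))"
    using Vitali_covering_lemma_cballs[OF cover r] by blast
  let ?I = "\<lambda>i. {q (u i)..q (v i)}"
  have disj: "?I i \<inter> ?I j = {}" if ij: "i \<in> C" "j \<in> C" "i \<noteq> j" for i j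
  proof -
    have "disjnt {p (u i)..p (v i)} {p (u j)..p (v j)}"
      using C(3) ij by (auto simp: pairwise_def ball)
    moreover have "p (u i) < p (v i)" "p (u j) < p (v j)"
      using uv(1) ij C(2) strict_monoD[OF p(1)] by blast+
    ultimately have "p (v i) < p (u j) \<or> p (v j) < p (u i)"
      by (auto simp: disjnt_def)
    then have "q (v i) < q (u j) \<or> q (v j) < q (u i)"
      using strict_mono_less[OF p(1)] strict_mono_less[OF q(1)] by blast
    then show ?thesis by auto
  qed
  have bound: "measure lebesgue (\<Union>i\<in>F. cball (a i) (5 * r i)) \<le> 5 * K * measure lebesgue V"
    if F: "F \<subseteq> C" "finite F" for F
  proof -
    have FE: "i \<in> E" if "i \<in> F" for i using that F C by blast
    have "measure lebesgue (\<Union>i\<in>F. cball (a i) (5 * r i))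
        \<le> (\<Sum>i\<in>F. measure lebesgue (cball (a i) (5 * r i)))"
      by (rule measure_UNION_le) (use F in auto)
    also have "\<dots> = (\<Sum>i\<in>F. 5 * (p (v i) - p (u i)))"
    proof (rule sum.cong[OF refl])
      fix i assume "i \<in> F"
      then show "measure lebesgue (cball (a i) (5 * r i)) = 5 * (p (v i) - p (u i))"
        using r[OF FE, of i] by (simp add: cball_eq_atLeastAtMost r_def field_simps)
    qed
    also have "\<dots> \<le> (\<Sum>i\<in>F. 5 * K * (q (v i) - q (u i)))"
    proof (rule sum_mono)
      fix i assume "i \<in> F"
      then show "5 * (p (v i) - p (u i)) \<le> 5 * K * (q (v i) - q (u i))"
        using uv(3)[OF FE, of i] by (simp add: mult.assoc)
    qed
    also have "\<dots> = 5 * K * (\<Sum>i\<in>F. measure lebesgue (?I i))"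
    proof -
      have "measure lebesgue (?I i) = q (v i) - q (u i)" if "i \<in> F" for i
        using strict_monoD[OF q(1) uv(1)[OF FE[OF that]]] by simp
      then show ?thesis by (simp add: sum_distrib_left)
    qed
    also have "(\<Sum>i\<in>F. measure lebesgue (?I i)) = measure lebesgue (\<Union>i\<in>F. ?I i)"
      by (rule measure_finite_Union[symmetric])
        (use F disj in \<open>auto simp: disjoint_family_on_def emeasure_lborel_Icc_eq subset_iff\<close>)
    also have "\<dots> \<le> measure lebesgue V"
      by (rule measure_mono_fmeasurable) (use V uv(5) FE F in \<open>auto intro!: sets.finite_UN\<close>)
    finally show ?thesis
      using \<open>0 \<le> K\<close> by (simp add: mult_left_mono)
  qed
  show ?thesis
    using fmeasurable_UN_bound[OF C(1) _ bound] measure_UN_bound[OF C(1) _ bound] C(4)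
    by (intro bexI[of _ "\<Union>i\<in>C. cball (a i) (5 * r i)"]) auto
qed

text \<open>Up to the negligible set \<open>p ` N\<close>, the whole interval from \<open>p s\<close> to \<open>p t\<close> is the image of
  points at which the increments compare, so its length is controlled by that of the corresponding
  \<open>q\<close>-interval. The factor 5 is the price of the covering argument; any constant would do below.\<close>

lemma increment_bound:
  fixes p q :: "real \<Rightarrow> real"
  assumes p: "strict_mono p" "continuous_on UNIV p" and q: "strict_mono q" "continuous_on UNIV q"
    and "0 \<le> K" "s < t" and N: "negligible (p ` N)"
    and freq: "\<And>x. x \<in> {s<..<t} - N \<Longrightarrow> \<exists>\<^sub>F y in at x. \<bar>p y - p x\<bar> \<le> K * \<bar>q y - q x\<bar>"
  shows "p t - p s \<le> 5 * K * (q t - q s)"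
proof -
  have st: "p s < p t" "q s < q t"
    using p(1) q(1) \<open>s < t\<close> by (auto dest: strict_monoD)
  have "q ` ({s<..<t} - N) \<subseteq> {q s<..<q t}"
    using strict_monoD[OF q(1)] by auto
  from vitali_image_bound[OF p q _ _ this \<open>0 \<le> K\<close> freq]
  obtain W where W: "W \<in> lmeasurable" "p ` ({s<..<t} - N) \<subseteq> W"
      "measure lebesgue W \<le> 5 * K * measure lebesgue {q s<..<q t}"
    by auto
  have "{p s<..<p t} \<subseteq> W \<union> p ` N"
  proof
    fix w assume w: "w \<in> {p s<..<p t}"
    then obtain x where "s \<le> x" "x \<le> t" "p x = w"
      using IVT'[of p s w t] \<open>s < t\<close> continuous_on_subset[OF p(2)] by auto
    then have "x \<in> {s<..<t}" using w by (auto simp: less_le)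
    then show "w \<in> W \<union> p ` N" using W(2) \<open>p x = w\<close> by blast
  qed
  then have "measure lebesgue {p s<..<p t} \<le> measure lebesgue (W \<union> p ` N)"
    using fmeasurable.Un[OF W(1) negligible_imp_measurable[OF N]]
    by (intro measure_mono_fmeasurable) auto
  also have "\<dots> \<le> measure lebesgue W + measure lebesgue (p ` N)"
    using W(1) N by (intro measure_Un_le) (auto simp: negligible_imp_sets)
  finally show ?thesis
    using W(3) N st by (simp add: negligible_imp_measure0)
qed

lemma negligible_outer_open:
  assumes "negligible E" "e > 0"
  obtains V where "open V" "E \<subseteq> V" "V \<in> lmeasurable" "measure lebesgue V < e"
proof -
  obtain T where T: "open T" "E \<subseteq> T" "T - E \<in> lmeasurable" "emeasure lebesgue (T - E) < ennreal e"
    using sets_lebesgue_outer_open[OF negligible_imp_sets[OF assms(1)] assms(2)] .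
  have "T = (T - E) \<union> E" using T(2) by auto
  then have "T \<in> lmeasurable"
    using T(3) negligible_imp_measurable[OF assms(1)] fmeasurable.Un by metis
  moreover have "measure lebesgue (T - E) = measure lebesgue T"
    using assms(1) \<open>T \<in> lmeasurable\<close>
    by (auto simp: negligible_iff_null_sets intro!: measure_Diff_null_set)
  moreover have "measure lebesgue (T - E) < e"
    using T(3,4) assms(2) by (simp add: emeasure_eq_measure2 ennreal_less_iff)
  ultimately show ?thesis using that T by simp
qed

lemma abs_increment_eq_slope:
  fixes g :: "real \<Rightarrow> real"
  assumes "strict_mono g" "y \<noteq> x"
  shows "\<bar>g y - g x\<bar> = (g y - g x) / (y - x) * \<bar>y - x\<bar>"
  using assms(2) strict_monoD[OF assms(1), of x y] strict_monoD[OF assms(1), of y x]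
  by (cases "x < y") (auto simp: abs_if field_simps)

text \<open>This is what excludes a singular part of \<open>g\<close>. At a point without derivative \<open>\<infinity>\<close> some bound
  \<open>k\<close> holds for difference quotients at arbitrarily small scales, so \<open>E\<close> is a countable union of
  sets \<open>Q k\<close> whose images have outer measure at most \<open>5 k\<close> times the measure of any open set
  containing \<open>E\<close>, which can be chosen as small as desired.\<close>

lemma negligible_strict_mono_image:
  fixes g :: "real \<Rightarrow> real"
  assumes g: "strict_mono g" "continuous_on UNIV g" and "negligible E"
    and noninf: "\<And>x. x \<in> E \<Longrightarrow> \<not> has_ext_derivative g \<infinity> x"
  shows "negligible (g ` E)"
proof -
  define Q where "Q k = {x\<in>E. \<exists>\<^sub>F y in at x. \<bar>g y - g x\<bar> \<le> real k * \<bar>y - x\<bar>}" for k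
  have "negligible (g ` Q k)" for k
    unfolding negligible_outer_le
  proof (intro allI impI)
    fix e :: real assume "e > 0"
    obtain V where V: "open V" "E \<subseteq> V" "V \<in> lmeasurable"
        "measure lebesgue V < e / (5 * (real k + 1))"
      using negligible_outer_open[OF \<open>negligible E\<close>, of "e / (5 * (real k + 1))"] \<open>e > 0\<close> by auto
    have "id ` Q k \<subseteq> V" using V(2) by (auto simp: Q_def)
    from vitali_image_bound[OF g strict_mono_id _ V(1,3) this, of "real k"]
    obtain W where W: "W \<in> lmeasurable" "g ` Q k \<subseteq> W"
        "measure lebesgue W \<le> 5 * real k * measure lebesgue V"
      by (auto simp: Q_def)
    note W(3)
    also have "5 * real k * measure lebesgue V \<le> 5 * (real k + 1) * (e / (5 * (real k + 1)))"
      using V(4) by (intro mult_mono) auto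
    also have "\<dots> = e"
      by (simp add: field_simps add_nonneg_eq_0_iff)
    finally show "\<exists>T. g ` Q k \<subseteq> T \<and> T \<in> lmeasurable \<and> measure lebesgue T \<le> e"
      using W by blast
  qed
  moreover have "E \<subseteq> (\<Union>k. Q k)"
  proof
    fix x assume "x \<in> E"
    from noninf[OF this] obtain r where
      "\<exists>\<^sub>F y in at x. \<not> ereal r < ereal ((g y - g x) / (y - x))"
      unfolding has_ext_derivative_def tendsto_PInfty by (auto simp: frequently_def)
    then have fr: "\<exists>\<^sub>F y in at x. (g y - g x) / (y - x) \<le> r"
      by (rule frequently_elim1) simp
    obtain k :: nat where k: "r \<le> real k" using real_arch_simple by blast
    have ne: "\<forall>\<^sub>F y in at x. y \<noteq> x" by (simp add: eventually_at_filter)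
    have "\<exists>\<^sub>F y in at x. \<bar>g y - g x\<bar> \<le> real k * \<bar>y - x\<bar>"
      using frequently_eventually_frequently[OF fr ne]
    proof (rule frequently_elim1, elim conjE)
      fix y assume y: "(g y - g x) / (y - x) \<le> r" "y \<noteq> x"
      have "(g y - g x) / (y - x) \<le> real k" using y k by linarith
      then show "\<bar>g y - g x\<bar> \<le> real k * \<bar>y - x\<bar>"
        unfolding abs_increment_eq_slope[OF g(1) y(2)] by (rule mult_right_mono) simp
    qed
    then show "x \<in> (\<Union>k. Q k)" using \<open>x \<in> E\<close> by (auto simp: Q_def)
  qed
  then have "g ` E \<subseteq> (\<Union>k. g ` Q k)" by blast
  ultimately show ?thesis
    by (meson negligible_Union_nat negligible_subset)
qed

section \<open>Smallness of the Lipschitz constant near minus infinity\<close>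

text \<open>Monotonicity of the derivative enters twice: at points of differentiability to the left of \<open>b\<close>
  the slope is at most \<open>D\<close>, and no point to the left of \<open>b\<close> can have derivative \<open>\<infinity>\<close>, so that
  \<open>g\<close> maps the null set of the remaining points to a null set.\<close>

lemma increment_le_left_of_derivative:
  fixes g :: "real \<Rightarrow> real"
  assumes g: "strict_mono g" "continuous_on UNIV g"
    and null: "negligible {x. \<not> g differentiable (at x)}"
    and mono: "\<And>x y D E. \<lbrakk>x \<le> y; has_ext_derivative g D x; has_ext_derivative g E y\<rbrakk> \<Longrightarrow> D \<le> E"
    and b: "(g has_real_derivative D) (at b)" "D < K" "0 \<le> K" "s < t" "t \<le> b"
  shows "g t - g s \<le> 5 * K * (t - s)"
proof -
  define N where "N = {x\<in>{..<b}. \<not> g differentiable (at x)}"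
  have b': "has_ext_derivative g (ereal D) b"
    using b(1) by (simp add: has_ext_derivative_ereal_iff)
  have "negligible N"
    by (rule negligible_subset[OF null]) (auto simp: N_def)
  then have "negligible (g ` N)"
  proof (rule negligible_strict_mono_image[OF g])
    fix x assume "x \<in> N"
    then show "\<not> has_ext_derivative g \<infinity> x"
      using mono[OF _ _ b', of x \<infinity>] by (auto simp: N_def)
  qed
  then have "g t - g s \<le> 5 * K * (id t - id s)"
  proof (rule increment_bound[OF g strict_mono_id continuous_on_id' b(3,4)])
    fix x assume x: "x \<in> {s<..<t} - N"
    then have "x < b" using b(5) by auto
    then have "g differentiable (at x)" using x by (auto simp: N_def)
    then obtain D' where D': "(g has_real_derivative D') (at x)"
      by (auto simp: real_differentiable_def)
    then have "D' \<le> D"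
      using mono[OF _ _ b', of x "ereal D'"] \<open>x < b\<close> by (simp add: has_ext_derivative_ereal_iff)
    then have "\<forall>\<^sub>F y in at x. (g y - g x) / (y - x) < K"
      using D' b(2) by (intro order_tendstoD(2)[of _ D']) (auto simp: has_field_derivative_iff)
    moreover have "\<forall>\<^sub>F y in at x. y \<noteq> x"
      by (simp add: eventually_at_filter)
    ultimately have "\<forall>\<^sub>F y in at x. \<bar>g y - g x\<bar> \<le> K * \<bar>id y - id x\<bar>"
      by eventually_elim
        (simp add: abs_increment_eq_slope[OF g(1)] mult_right_mono del: times_divide_eq_left)
    then show "\<exists>\<^sub>F y in at x. \<bar>g y - g x\<bar> \<le> K * \<bar>id y - id x\<bar>"
      by (rule eventually_frequently[OF trivial_limit_at])
  qed
  then show ?thesis by simp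
qed

text \<open>If all derivatives to the left of \<open>B\<close> were at least \<open>\<epsilon>\<close>, then \<open>g\<close> would have to grow at
  a definite linear rate there, which a positive increasing function cannot do along a half-line
  that is unbounded to the left.\<close>

lemma small_derivative_far_left:
  fixes g :: "real \<Rightarrow> real"
  assumes g: "strict_mono g" "continuous_on UNIV g" and pos: "\<And>x. 0 < g x"
    and null: "negligible {x. \<not> g differentiable (at x)}" and "0 < \<epsilon>"
  obtains b D where "b < B" "(g has_real_derivative D) (at b)" "D < \<epsilon>"
proof (rule ccontr)
  assume "\<not> thesis"
  with that have large: "\<epsilon> \<le> D" if "x < B" "(g has_real_derivative D) (at x)" for x D
    using that not_less by blast
  \<comment> \<open>The length of \<open>[s, B]\<close> exceeds by one the bound \<open>5 * (2 / \<epsilon>) * g B\<close> that the increment of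
    \<open>g\<close> will impose on it.\<close>
  define s where "s = B - 10 / \<epsilon> * g B - 1"
  have "0 < 10 / \<epsilon> * g B" using pos[of B] \<open>0 < \<epsilon>\<close> by simp
  then have "s < B" by (simp add: s_def)
  \<comment> \<open>Slopes are only known to be eventually close to a derivative \<open>\<ge> \<epsilon>\<close>, hence \<open>\<epsilon> / 2\<close>.\<close>
  have "id B - id s \<le> 5 * (2 / \<epsilon>) * (g B - g s)"
  proof (rule increment_bound[OF strict_mono_id _ g _ \<open>s < B\<close>,
        where N = "{x. \<not> g differentiable (at x)}"])
    fix x assume x: "x \<in> {s<..<B} - {x. \<not> g differentiable (at x)}"
    then obtain D where D: "(g has_real_derivative D) (at x)"
      by (auto simp: real_differentiable_def)
    then have "\<epsilon> / 2 < D" using large[OF _ D] x \<open>0 < \<epsilon>\<close> by auto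
    then have "\<forall>\<^sub>F y in at x. \<epsilon> / 2 < (g y - g x) / (y - x)"
      using D by (intro order_tendstoD(1)[of _ D]) (auto simp: has_field_derivative_iff)
    moreover have "\<forall>\<^sub>F y in at x. y \<noteq> x"
      by (simp add: eventually_at_filter)
    ultimately have "\<forall>\<^sub>F y in at x. \<bar>id y - id x\<bar> \<le> 2 / \<epsilon> * \<bar>g y - g x\<bar>"
    proof eventually_elim
      case (elim y)
      have "\<epsilon> / 2 * \<bar>y - x\<bar> \<le> \<bar>g y - g x\<bar>"
        unfolding abs_increment_eq_slope[OF g(1) elim(2)]
        by (rule mult_right_mono) (use elim in auto)
      then show ?case using \<open>0 < \<epsilon>\<close> by (simp add: field_simps)
    qed
    then show "\<exists>\<^sub>F y in at x. \<bar>id y - id x\<bar> \<le> 2 / \<epsilon> * \<bar>g y - g x\<bar>"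
      by (rule eventually_frequently[OF trivial_limit_at])
  qed (use null \<open>0 < \<epsilon>\<close> in auto)
  also have "\<dots> \<le> 5 * (2 / \<epsilon>) * g B"
    using pos[of s] \<open>0 < \<epsilon>\<close> by (intro mult_left_mono) auto
  finally show False by (simp add: s_def)
qed

lemma admissible_g_lipschitz_near_at_bot:
  assumes "admissible_g c g" and "0 < \<epsilon>"
  obtains b where "b < B" "\<epsilon>-lipschitz_on {..b} g"
proof -
  have g: "strict_mono g" "continuous_on UNIV g" and pos: "\<And>x. 0 < g x"
    and ae: "AE x in lborel. g differentiable (at x)"
    and mono: "\<And>x y D E. \<lbrakk>x \<le> y; has_ext_derivative g D x; has_ext_derivative g E y\<rbrakk> \<Longrightarrow> D \<le> E"
    using assms(1) unfolding admissible_g_def by blast+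
  have "AE x in lebesgue. g differentiable (at x)"
    using ae by (rule AE_completion)
  then have null: "negligible {x. \<not> g differentiable (at x)}"
    by (auto simp: eventually_ae_filter_negligible intro: negligible_subset)
  obtain b D where b: "b < B" "(g has_real_derivative D) (at b)" "D < \<epsilon> / 5"
    using small_derivative_far_left[OF g pos null, of "\<epsilon> / 5"] \<open>0 < \<epsilon>\<close> by auto
  have step: "g t - g s \<le> \<epsilon> * (t - s)" if "s < t" "t \<le> b" for s t
    using increment_le_left_of_derivative[OF g null mono b(2,3) _ that] \<open>0 < \<epsilon>\<close> by simp
  have "\<epsilon>-lipschitz_on {..b} g"
  proof (rule lipschitz_onI)
    fix x y assume xy: "x \<in> {..b}" "y \<in> {..b}"
    show "dist (g x) (g y) \<le> \<epsilon> * dist x y"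
      using xy step[of x y] step[of y x] strict_monoD[OF g(1), of x y] strict_monoD[OF g(1), of y x]
      by (cases x y rule: linorder_cases) (auto simp: dist_real_def abs_if)
  qed (use \<open>0 < \<epsilon>\<close> in simp)
  with b(1) show ?thesis by (rule that)
qed

section \<open>Contraction on a left half-plane\<close>

text \<open>On each interval of length \<open>\<pi>\<close> centred at a multiple of \<open>\<pi>\<close>, the function \<open>h\<close> is up to sign
  a translate of its restriction to \<open>[-\<pi>/2, \<pi>/2]\<close>. These intervals are closed and consecutive ones
  share an endpoint, so the Lipschitz bounds glue with the same constant.\<close>

lemma admissible_h_lipschitz:
  assumes "admissible_h \<eta> h"
  obtains L where "L-lipschitz_on UNIV h"
proof -
  obtain L where "L > 0" and L: "\<And>x y. x \<in> {-(pi/2)..pi/2} \<Longrightarrow> y \<in> {-(pi/2)..pi/2} \<Longrightarrow>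
      dist (h x) (h y) \<le> L * dist x y"
  proof -
    have "bilipschitz_on {-(pi/2)..pi/2} h"
      using assms by (simp add: admissible_h_def)
    then show ?thesis
      using that unfolding bilipschitz_on_def by meson
  qed
  have ext: "h y = (if even p then h (y + of_int p * pi) else - h (y + of_int p * pi))"
    if "y + of_int p * pi \<in> {-(pi/2)..pi/2}" for y and p :: int
  proof -
    have "\<forall>y. \<forall>y'\<in>{-(pi/2)..pi/2}. \<forall>p::int. y' = y + of_int p * pi \<longrightarrow>
        h y = (if even p then h y' else - h y')"
      using assms by (simp add: admissible_h_def)
    with that show ?thesis by blast
  qed
  define U where "U k = {of_int k * pi - pi/2..of_int k * pi + pi/2}" for k :: int
  have piece: "L-lipschitz_on (U k) h" for k
  proof (rule lipschitz_onI)
    fix x y assume "x \<in> U k" "y \<in> U k"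
    then have xy: "x + of_int (-k) * pi \<in> {-(pi/2)..pi/2}" "y + of_int (-k) * pi \<in> {-(pi/2)..pi/2}"
      by (auto simp: U_def)
    have "dist (h x) (h y) = dist (h (x + of_int (-k) * pi)) (h (y + of_int (-k) * pi))"
      using ext[OF xy(1)] ext[OF xy(2)] by (simp add: dist_minus)
    also have "\<dots> \<le> L * dist x y"
      using L[OF xy] by (simp add: dist_real_def)
    finally show "dist (h x) (h y) \<le> L * dist x y" .
  qed (use \<open>L > 0\<close> in simp)
  have "L-lipschitz_on {-r..r} h" for r
  proof (rule lipschitz_on_closed_Union)
    define n :: int where "n = \<lceil>\<bar>r\<bar> / pi\<rceil> + 1"
    show "{-r..r} \<subseteq> (\<Union>k\<in>{-n..n}. U k)"
    proof
      fix x assume x: "x \<in> {-r..r}"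
      define k where "k = \<lfloor>x / pi + 1/2\<rfloor>"
      have "of_int k \<le> x / pi + 1/2" "x / pi + 1/2 < of_int k + 1"
        unfolding k_def by linarith+
      then have k: "of_int k * pi \<le> x + pi/2" "x + pi/2 < of_int k * pi + pi"
        by (simp_all add: field_simps)
      have "x / pi \<le> \<bar>r\<bar> / pi" "- (\<bar>r\<bar> / pi) \<le> x / pi"
        using x by (auto simp: field_simps)
      then have "- n \<le> k" "k \<le> n"
        unfolding k_def n_def by linarith+
      then have "k \<in> {-n..n}" by simp
      moreover have "x \<in> U k"
        using k by (auto simp: U_def)
      ultimately show "x \<in> (\<Union>k\<in>{-n..n}. U k)" by blast
    qed
  qed (use piece \<open>L > 0\<close> in \<open>auto simp: U_def\<close>)
  then have "dist (h x) (h y) \<le> L * dist x y" for x y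
    by (rule lipschitz_onD[where X = "{- max \<bar>x\<bar> \<bar>y\<bar> .. max \<bar>x\<bar> \<bar>y\<bar>}"]) auto
  then have "L-lipschitz_on UNIV h"
    using \<open>L > 0\<close> by (auto intro: lipschitz_onI)
  then show ?thesis by (rule that)
qed

text \<open>Because \<open>|h| \<le> 1\<close>, the product rule shows that the Lipschitz constant of \<open>Z\<close> on a left
  half-plane is at most that of \<open>g\<close> plus \<open>L\<close> times the supremum of \<open>g\<close>, where \<open>L\<close> is a Lipschitz
  constant of \<open>h\<close>. Far enough to the left each of the two contributions is at most \<open>1/4\<close>.\<close>

lemma Z_map_half_lipschitz_near_at_bot:
  assumes g: "admissible_g c g" and h: "admissible_h \<eta> h" "\<And>y. norm (h y) \<le> 1"
  obtains b where "b < 0" "(1/2)-lipschitz_on (\<H> b) (Z_map g h)"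
proof -
  obtain L where L: "L-lipschitz_on UNIV h"
    using admissible_h_lipschitz[OF h(1)] .
  then have "0 \<le> L" by (rule lipschitz_on_nonneg)
  have pos: "\<And>x. 0 < g x" and lim: "(g \<longlongrightarrow> 0) at_bot"
    using g unfolding admissible_g_def by blast+
  \<comment> \<open>\<open>L + 1\<close> instead of \<open>L\<close> keeps the denominator positive.\<close>
  have "\<forall>\<^sub>F x in at_bot. g x < 1 / (4 * (L + 1))"
    using lim \<open>0 \<le> L\<close> by (intro order_tendstoD(2)) auto
  then obtain B where B: "\<And>x. x \<le> B \<Longrightarrow> g x < 1 / (4 * (L + 1))"
    by (auto simp: eventually_at_bot_linorder)
  obtain b where b: "b < min B 0" "(1/4)-lipschitz_on {..b} g"
    using admissible_g_lipschitz_near_at_bot[OF g, of "1/4" "min B 0"] by auto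
  have "(1/2)-lipschitz_on (\<H> b) (Z_map g h)"
  proof (rule lipschitz_onI)
    fix z w assume zw: "z \<in> \<H> b" "w \<in> \<H> b"
    have g1: "norm (g (Re z) - g (Re w)) \<le> 1/4 * norm (z - w)"
    proof -
      have "norm (g (Re z) - g (Re w)) \<le> 1/4 * \<bar>Re z - Re w\<bar>"
        using lipschitz_onD[OF b(2), of "Re z" "Re w"] zw by (simp add: half_plane_def dist_real_def)
      also have "\<dots> \<le> 1/4 * norm (z - w)"
        using abs_Re_le_cmod[of "z - w"] by simp
      finally show ?thesis .
    qed
    have h1: "norm (h (Im z) - h (Im w)) \<le> L * norm (z - w)"
    proof -
      have "norm (h (Im z) - h (Im w)) \<le> L * \<bar>Im z - Im w\<bar>"
        using lipschitz_on_normD[OF L, of "Im z" "Im w"] by simp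
      also have "\<dots> \<le> L * norm (z - w)"
        using abs_Im_le_cmod[of "z - w"] \<open>0 \<le> L\<close> by (simp add: mult_left_mono)
      finally show ?thesis .
    qed
    have "Z_map g h z - Z_map g h w =
        of_real (g (Re z) - g (Re w)) * h (Im z) + of_real (g (Re w)) * (h (Im z) - h (Im w))"
      by (simp add: Z_map_def algebra_simps)
    also have "norm \<dots> \<le> norm (g (Re z) - g (Re w)) * norm (h (Im z))
        + g (Re w) * norm (h (Im z) - h (Im w))"
      by (rule order_trans[OF norm_triangle_ineq])
        (use pos[of "Re w"] in \<open>simp add: norm_mult del: of_real_diff\<close>)
    also have "\<dots> \<le> (1/4 * norm (z - w)) * 1 + 1 / (4 * (L + 1)) * (L * norm (z - w))"
      using g1 h1 h(2) B[of "Re w"] zw b(1) pos[of "Re w"] \<open>0 \<le> L\<close>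
      by (intro add_mono mult_mono) (auto simp: half_plane_def intro: less_imp_le)
    also have "\<dots> \<le> 1/4 * norm (z - w) + 1/4 * norm (z - w)"
      using \<open>0 \<le> L\<close> by (simp add: field_simps mult_left_mono)
    finally show "dist (Z_map g h z) (Z_map g h w) \<le> 1/2 * dist z w"
      by (simp add: dist_norm)
  qed simp
  moreover have "b < 0" using b(1) by simp
  ultimately show ?thesis using that by blast
qed

section \<open>The attracting fixed point\<close>

text \<open>Banach's fixed point theorem on \<open>S\<close>, adapted to a map that contracts only a uniform
  neighbourhood \<open>U\<close> of \<open>S\<close> but sends a still larger set \<open>T\<close> into \<open>S\<close> in one step. The
  neighbourhood is what makes the fixed point attracting also for points outside \<open>S\<close>, since \<open>\<xi>\<close>
  may lie on the boundary of \<open>S\<close>.\<close>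

lemma contraction_attracting_fixed_point:
  fixes f :: "'a::metric_space \<Rightarrow> 'a"
  assumes S: "complete S" "S \<noteq> {}" and "0 < e" and nbhd: "\<And>x. x \<in> S \<Longrightarrow> ball x e \<subseteq> U"
    and contr: "c-lipschitz_on U f" "c < 1" and into: "f ` T \<subseteq> S" and "S \<subseteq> U" "U \<subseteq> T"
  shows "\<exists>\<xi>\<in>S. attracting_fixed_point f \<xi> \<and> (\<forall>\<zeta>\<in>S. attracting_fixed_point f \<zeta> \<longrightarrow> \<zeta> = \<xi>) \<and>
           (\<forall>z\<in>T. (\<lambda>n. (f ^^ n) z) \<longlonglongrightarrow> \<xi>)"
proof -
  have c: "0 \<le> c" using contr(1) by (rule lipschitz_on_nonneg)
  have "\<exists>!x. x \<in> S \<and> f x = x"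
  proof (rule Banach_fix[OF S c contr(2)])
    show "f ` S \<subseteq> S" using into \<open>S \<subseteq> U\<close> \<open>U \<subseteq> T\<close> by blast
  qed (use \<open>S \<subseteq> U\<close> in \<open>auto intro: lipschitz_onD[OF contr(1)]\<close>)
  then obtain \<xi> where \<xi>: "\<xi> \<in> S" "f \<xi> = \<xi>" and uniq: "\<And>\<zeta>. \<zeta> \<in> S \<Longrightarrow> f \<zeta> = \<zeta> \<Longrightarrow> \<zeta> = \<xi>"
    by blast
  have geo: "(f ^^ n) z \<in> U \<and> dist ((f ^^ n) z) \<xi> \<le> c ^ n * dist z \<xi>" if "z \<in> U" for n z
  proof (induction n)
    case 0
    then show ?case using that by simp
  next
    case (Suc n)
    have "dist (f ((f ^^ n) z)) \<xi> \<le> c * dist ((f ^^ n) z) \<xi>"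
      using lipschitz_onD[OF contr(1), of "(f ^^ n) z" \<xi>] Suc \<xi> \<open>S \<subseteq> U\<close> by auto
    also have "\<dots> \<le> c * (c ^ n * dist z \<xi>)"
      using Suc c by (intro mult_left_mono) auto
    finally show ?case
      using Suc into \<open>S \<subseteq> U\<close> \<open>U \<subseteq> T\<close> by (auto simp: mult.assoc)
  qed
  have c0: "(\<lambda>n. c ^ n * r) \<longlonglongrightarrow> 0" for r
    using tendsto_mult_left_zero[OF LIMSEQ_power_zero[of c]] c contr(2) by simp
  have "uniform_limit (ball \<xi> e) (\<lambda>n. f ^^ n) (\<lambda>_. \<xi>) sequentially"
  proof (rule uniform_limitI)
    fix \<delta> :: real assume "\<delta> > 0"
    with c0[of e] have "\<forall>\<^sub>F n in sequentially. c ^ n * e < \<delta>"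
      by (intro order_tendstoD(2)) auto
    then show "\<forall>\<^sub>F n in sequentially. \<forall>z\<in>ball \<xi> e. dist ((f ^^ n) z) \<xi> < \<delta>"
    proof eventually_elim
      case (elim n)
      show ?case
      proof
        fix z assume z: "z \<in> ball \<xi> e"
        then have "dist ((f ^^ n) z) \<xi> \<le> c ^ n * dist z \<xi>"
          using geo nbhd[OF \<xi>(1)] by blast
        also have "\<dots> \<le> c ^ n * e"
          using z c by (intro mult_left_mono) (auto simp: dist_commute)
        finally show "dist ((f ^^ n) z) \<xi> < \<delta>" using elim by simp
      qed
    qed
  qed
  then have "attracting_fixed_point f \<xi>"
    unfolding attracting_fixed_point_def using \<xi>(2) \<open>0 < e\<close>
    by (intro conjI exI[of _ "ball \<xi> e"]) auto
  moreover have "(\<lambda>n. (f ^^ n) z) \<longlonglongrightarrow> \<xi>" if "z \<in> T" for z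
  proof -
    have "f z \<in> U" using that into \<open>S \<subseteq> U\<close> by blast
    have "(\<lambda>n. dist ((f ^^ n) (f z)) \<xi>) \<longlonglongrightarrow> 0"
      by (rule tendsto_sandwich[OF _ _ tendsto_const c0[of "dist (f z) \<xi>"]])
        (use geo[OF \<open>f z \<in> U\<close>] in auto)
    then have "(\<lambda>n. (f ^^ Suc n) z) \<longlonglongrightarrow> \<xi>"
      by (simp add: tendsto_dist_iff[symmetric] funpow_swap1)
    then show ?thesis
      by (rule LIMSEQ_imp_Suc)
  qed
  moreover have "\<zeta> = \<xi>" if "\<zeta> \<in> S" "attracting_fixed_point f \<zeta>" for \<zeta>
    using uniq that by (simp add: attracting_fixed_point_def)
  ultimately show ?thesis
    using \<xi>(1) by blast
qed

theorem theorem1p2: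
  fixes g :: "real \<Rightarrow> real" and h :: "real \<Rightarrow> complex"
    and \<eta> :: "complex set" and h\<^sub>m\<^sub>i\<^sub>n :: real
  assumes "admissible_curve \<eta>"
    and "admissible_h \<eta> h"
    and "0 < h\<^sub>m\<^sub>i\<^sub>n" and "h\<^sub>m\<^sub>i\<^sub>n < 1"
    and "\<And>y. h\<^sub>m\<^sub>i\<^sub>n \<le> norm (h y)" and "\<And>y. norm (h y) \<le> 1"
    and "admissible_g h\<^sub>m\<^sub>i\<^sub>n g"
  shows "\<exists>m<0. \<exists>M>0. \<forall>\<^sub>F a in at_top.
           \<exists>\<xi>\<in>\<H> m.
             attracting_fixed_point (gen_exp g h a) \<xi> \<and>
             (\<forall>\<zeta>\<in>\<H> m. attracting_fixed_point (gen_exp g h a) \<zeta> \<longrightarrow> \<zeta> = \<xi>) \<and>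
             gen_exp g h a ` \<H> M \<subseteq> \<H> m \<and>
             (\<forall>z\<in>\<H> M. (\<lambda>n. (gen_exp g h a ^^ n) z) \<longlonglongrightarrow> \<xi>)"
proof -
  obtain b where b: "b < 0" "(1/2)-lipschitz_on (\<H> b) (Z_map g h)"
    using Z_map_half_lipschitz_near_at_bot[OF assms(7,2,6)] .
  have g: "\<And>x. 0 < g x" "mono g"
    using assms(7) unfolding admissible_g_def by (blast intro: strict_mono_mono)+
  \<comment> \<open>The half-planes \<open>\<H> (b - 1)\<close>, \<open>\<H> b\<close> and \<open>\<H> 1\<close> serve as \<open>S\<close>, \<open>U\<close> and \<open>T\<close> in the fixed point
    lemma; the unit gap between the first two provides the uniform neighbourhood.\<close>
  let ?good = "\<lambda>a. \<exists>\<xi>\<in>\<H> (b - 1).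
             attracting_fixed_point (gen_exp g h a) \<xi> \<and>
             (\<forall>\<zeta>\<in>\<H> (b - 1). attracting_fixed_point (gen_exp g h a) \<zeta> \<longrightarrow> \<zeta> = \<xi>) \<and>
             gen_exp g h a ` \<H> 1 \<subseteq> \<H> (b - 1) \<and>
             (\<forall>z\<in>\<H> 1. (\<lambda>n. (gen_exp g h a ^^ n) z) \<longlonglongrightarrow> \<xi>)"
  have "?good a" if a: "g 1 - (b - 1) \<le> a" for a
  proof -
    have into: "gen_exp g h a ` \<H> 1 \<subseteq> \<H> (b - 1)"
    proof
      fix w assume "w \<in> gen_exp g h a ` \<H> 1"
      then obtain z where z: "Re z \<le> 1" "w = gen_exp g h a z"
        by (auto simp: half_plane_def)
      have "Re (Z_map g h z) \<le> norm (Z_map g h z)" by (rule complex_Re_le_cmod)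
      also have "\<dots> = g (Re z) * norm (h (Im z))"
        using g(1)[of "Re z"] by (simp add: Z_map_def norm_mult)
      also have "\<dots> \<le> g 1 * 1"
        using monoD[OF g(2) z(1)] g(1)[of 1] assms(6) by (intro mult_mono) auto
      finally show "w \<in> \<H> (b - 1)"
        using a z(2) by (simp add: half_plane_def gen_exp_def)
    qed
    have contr: "(1/2)-lipschitz_on (\<H> b) (gen_exp g h a)"
      using b(2) by (simp add: lipschitz_on_def gen_exp_def dist_norm)
    have closed: "complete (\<H> (b - 1))"
      by (simp add: complete_eq_closed half_plane_def closed_halfspace_Re_le)
    have nonempty: "\<H> (b - 1) \<noteq> {}"
      by (auto simp: half_plane_def intro: exI[of _ "of_real (b - 1)"])
    have nbhd: "ball x 1 \<subseteq> \<H> b" if "x \<in> \<H> (b - 1)" for x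
    proof
      fix z assume "z \<in> ball x 1"
      then show "z \<in> \<H> b"
        using that abs_Re_le_cmod[of "z - x"]
        by (auto simp: half_plane_def dist_norm norm_minus_commute)
    qed
    have "\<H> (b - 1) \<subseteq> \<H> b" "\<H> b \<subseteq> \<H> 1"
      using b(1) by (auto simp: half_plane_def)
    from contraction_attracting_fixed_point[OF closed nonempty zero_less_one nbhd contr _ into this]
      into show ?thesis by auto
  qed
  then have "\<forall>\<^sub>F a in at_top. ?good a"
    by (auto simp: eventually_at_top_linorder)
  then show ?thesis
    using b(1) by (intro exI[of _ "b - 1"] conjI exI[of _ 1]) auto
qed

end
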